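(* Let $A$ be an infinitesimal bialgebra over a field $\Bbbk$, and let $\mathrm{End}(A)$ be the space of linear endomorphisms of $A$. Then the operations on $\mathrm{End}(A)$ defined, for $T,S\in\mathrm{End}(A)$, by \begin{align*} T\searrow S&=(\mathrm{id}\ast T\ast\mathrm{id})S,\\ T\nearrow S&=(\mathrm{id}\ast T)(S\ast\mathrm{id}),\\ T\swarrow S&=(T\ast\mathrm{id})(\mathrm{id}\ast S),\\ T\nwarrow S&=T(\mathrm{id}\ast S\ast\mathrm{id}) \end{align*} make $\mathrm{End}(A)$ into a quadri-algebra, where juxtaposition denotes composition of endomorphisms ($TS$ is $S$ followed by $T$) and $\ast$ denotes convolution.
   Context: An infinitesimal bialgebra is a triple $(A,\mu,\Delta)$ where $(A,\mu)$ is an associative algebra, $(A,\Delta)$ is a coassociative coalgebra (no unit or counit is required), and for all $a,b\in A$, $\Delta(ab)=ab_1\otimes b_2+a_1\otimes a_2b$, where $\Delta(a)=a_1\otimes a_2$ is Sweedler notation (with summation suppressed). The convolution of $T,S\in\mathrm{End}(A)$ is $T\ast S:=\mu\circ(T\otimes S)\circ\Delta$; it is an associative product on $\mathrm{End}(A)$. A quadri-algebra is a vector space $Q$ with four bilinear operations $\searrow,\nearrow,\nwarrow,\swarrow:Q\otimes Q\to Q$ such that, setting $x\succ y:=x\nearrow y+x\searrow y$, $x\prec y:=x\nwarrow y+x\swarrow y$, $x\vee y:=x\searrow y+x\swarrow y$, $x\wedge y:=x\nearrow y+x\nwarrow y$, and $x\star y:=x\searrow y+x\nearrow y+x\nwarrow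 y+x\swarrow y$, the following nine identities hold for all $x,y,z\in Q$: \begin{align*} &(x\nwarrow y)\nwarrow z=x\nwarrow(y\star z), && (x\nearrow y)\nwarrow z=x\nearrow(y\prec z), && (x\wedge y)\nearrow z=x\nearrow(y\succ z),\\ &(x\swarrow y)\nwarrow z=x\swarrow(y\wedge z), && (x\searrow y)\nwarrow z=x\searrow(y\nwarrow z), && (x\vee y)\nearrow z=x\searrow(y\nearrow z),\\ &(x\prec y)\swarrow z=x\swarrow(y\vee z), && (x\succ y)\swarrow z=x\searrow(y\swarrow z), && (x\star y)\searrow z=x\searrow(y\searrow z). \end{align*} *)

theory Defs
  imports
    Complex_Main
    "HOL-Library.Poly_Mapping"
    "HOL-Library.Set_Algebras"
    "HOL-Library.Function_Algebras"
begin

section \<open>Free vector spaces\<close>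

text \<open>The type \<open>'x \<Rightarrow>\<^sub>0 'k\<close> is the free \<open>'k\<close>-vector space on \<open>'x\<close>, with basis vectors
  \<open>Poly_Mapping.single x 1\<close>.\<close>

definition free_scale :: "'k::field \<Rightarrow> ('x \<Rightarrow>\<^sub>0 'k) \<Rightarrow> ('x \<Rightarrow>\<^sub>0 'k)"
  where "free_scale c f = Poly_Mapping.map ((*) c) f"

definition free_lift :: "('k::field \<Rightarrow> 'v \<Rightarrow> 'v::ab_group_add) \<Rightarrow> ('x \<Rightarrow> 'v) \<Rightarrow> ('x \<Rightarrow>\<^sub>0 'k) \<Rightarrow> 'v"
  where "free_lift s g f = (\<Sum>x\<in>Poly_Mapping.keys f. s (Poly_Mapping.lookup f x) (g x))"

lemma lookup_free_scale [simp]: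
  "Poly_Mapping.lookup (free_scale c f) x = c * Poly_Mapping.lookup f x"
  unfolding free_scale_def by transfer (simp add: when_def)

lemma free_scale_single [simp]:
  "free_scale c (Poly_Mapping.single x d) = Poly_Mapping.single x (c * d)"
  by (rule poly_mapping_eqI) (simp add: lookup_single when_def)

interpretation free: vector_space free_scale
  by standard (auto intro!: poly_mapping_eqI simp: lookup_add algebra_simps)

lemma free_lift_superset:
  assumes "vector_space s" "finite K" "Poly_Mapping.keys f \<subseteq> K"
  shows "free_lift s g f = (\<Sum>x\<in>K. s (Poly_Mapping.lookup f x) (g x))"
proof -
  interpret vector_space s by fact
  show ?thesis
    unfolding free_lift_def using assms(2,3)
    by (intro sum.mono_neutral_left) (auto simp: in_keys_iff)
qed

lemma linear_free_lift:
  assumes "vector_space s"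
  shows "Vector_Spaces.linear free_scale s (free_lift s g)"
proof -
  interpret vector_space s by fact
  show ?thesis
  proof (unfold_locales, goal_cases)
    case (1 f f')
    let ?K = "Poly_Mapping.keys f \<union> Poly_Mapping.keys f'"
    have "Poly_Mapping.keys (f + f') \<subseteq> ?K" by (rule keys_add)
    then show ?case
      by (simp add: free_lift_superset[OF assms, of ?K] lookup_add scale_left_distrib sum.distrib)
  next
    case (2 c f)
    have "Poly_Mapping.keys (free_scale c f) \<subseteq> Poly_Mapping.keys f" by (auto simp: in_keys_iff)
    then show ?case
      by (simp add: free_lift_superset[OF assms, of "Poly_Mapping.keys f"] scale_sum_right)
  qed
qed

lemma free_lift_single:
  assumes "vector_space s"
  shows "free_lift s g (Poly_Mapping.single x c) = s c (g x)"
proof -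
  interpret vector_space s by fact
  show ?thesis by (simp add: free_lift_superset[OF assms, of "{x}"])
qed

section \<open>Tensor powers\<close>

text \<open>\<open>A \<otimes> A\<close> is the quotient of the free vector space on \<open>A \<times> A\<close> by the subspace \<open>null2\<close>, and
  \<open>A \<otimes> A \<otimes> A\<close> the quotient of the free vector space on \<open>A \<times> A \<times> A\<close> by \<open>null3\<close>.  As these
  subspaces depend on the scalar multiplication of \<open>A\<close>, which is a term, the quotients are
  not types; their elements are the cosets \<open>f +o null2 s\<close> and \<open>f +o null3 s\<close>.  Addition of
  cosets is the elementwise addition of sets, and \<open>c\<close> times the coset \<open>X\<close> is
  \<open>free_scale c ` X + null2 s\<close> (the summand \<open>null2 s\<close> matters only for \<open>c = 0\<close>).\<close>

definition null2 :: "('k::field \<Rightarrow> 'a \<Rightarrow> 'a::ab_group_add) \<Rightarrow> (('a \<times> 'a) \<Rightarrow>\<^sub>0 'k) set"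
  where "null2 s = free.span (
      {Poly_Mapping.single (a + a', b) 1 - Poly_Mapping.single (a, b) 1
        - Poly_Mapping.single (a', b) 1 | a a' b. True}
    \<union> {Poly_Mapping.single (a, b + b') 1 - Poly_Mapping.single (a, b) 1
        - Poly_Mapping.single (a, b') 1 | a b b'. True}
    \<union> {Poly_Mapping.single (s c a, b) 1 - Poly_Mapping.single (a, b) c | c a b. True}
    \<union> {Poly_Mapping.single (a, s c b) 1 - Poly_Mapping.single (a, b) c | c a b. True})"

definition null3 :: "('k::field \<Rightarrow> 'a \<Rightarrow> 'a::ab_group_add) \<Rightarrow> (('a \<times> 'a \<times> 'a) \<Rightarrow>\<^sub>0 'k) set"
  where "null3 s = free.span (
      {Poly_Mapping.single (x + x', y, z) 1 - Poly_Mapping.single (x, y, z) 1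
        - Poly_Mapping.single (x', y, z) 1 | x x' y z. True}
    \<union> {Poly_Mapping.single (x, y + y', z) 1 - Poly_Mapping.single (x, y, z) 1
        - Poly_Mapping.single (x, y', z) 1 | x y y' z. True}
    \<union> {Poly_Mapping.single (x, y, z + z') 1 - Poly_Mapping.single (x, y, z) 1
        - Poly_Mapping.single (x, y, z') 1 | x y z z'. True}
    \<union> {Poly_Mapping.single (s c x, y, z) 1 - Poly_Mapping.single (x, y, z) c | c x y z. True}
    \<union> {Poly_Mapping.single (x, s c y, z) 1 - Poly_Mapping.single (x, y, z) c | c x y z. True}
    \<union> {Poly_Mapping.single (x, y, s c z) 1 - Poly_Mapping.single (x, y, z) c | c x y z. True})"

definition tensor2 :: "('k::field \<Rightarrow> 'a \<Rightarrow> 'a::ab_group_add) \<Rightarrow> (('a \<times> 'a) \<Rightarrow>\<^sub>0 'k) set set"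
  where "tensor2 s = {f +o null2 s | f. True}"

text \<open>Maps out of \<open>A \<otimes> A\<close> are given on a representative of the coset.  For linear \<open>T\<close>, \<open>S\<close>,
  \<open>\<Delta>\<close> and bilinear \<open>mu\<close> the result does not depend on the choice: see \<open>free_lift_rep2\<close>, \<open>tensor_mult_coset\<close>,
  \<open>tensor_map_coset\<close>, \<open>comult_tensor_id_coset\<close> and \<open>id_tensor_comult_coset\<close> below.\<close>

definition rep2 :: "(('a \<times> 'a) \<Rightarrow>\<^sub>0 'k::zero) set \<Rightarrow> ('a \<times> 'a) \<Rightarrow>\<^sub>0 'k"
  where "rep2 X = (SOME f. f \<in> X)"

text \<open>The map \<open>A \<otimes> A \<rightarrow> A\<close>, \<open>x \<otimes> y \<mapsto> mu x y\<close>.\<close>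
definition tensor_mult ::
    "('k::field \<Rightarrow> 'a \<Rightarrow> 'a::ab_group_add) \<Rightarrow> ('a \<Rightarrow> 'a \<Rightarrow> 'a) \<Rightarrow> (('a \<times> 'a) \<Rightarrow>\<^sub>0 'k) set \<Rightarrow> 'a"
  where "tensor_mult s mu X = free_lift s (\<lambda>(x, y). mu x y) (rep2 X)"

text \<open>The map \<open>T \<otimes> S : A \<otimes> A \<rightarrow> A \<otimes> A\<close>.\<close>
definition tensor_map ::
    "('k::field \<Rightarrow> 'a \<Rightarrow> 'a::ab_group_add) \<Rightarrow> ('a \<Rightarrow> 'a) \<Rightarrow> ('a \<Rightarrow> 'a) \<Rightarrow>
      (('a \<times> 'a) \<Rightarrow>\<^sub>0 'k) set \<Rightarrow> (('a \<times> 'a) \<Rightarrow>\<^sub>0 'k) set"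
  where "tensor_map s T S X =
    free_lift free_scale (\<lambda>(x, y). Poly_Mapping.single (T x, S y) 1) (rep2 X) +o null2 s"

text \<open>The map \<open>\<Delta> \<otimes> id : A \<otimes> A \<rightarrow> A \<otimes> A \<otimes> A\<close>.\<close>
definition comult_tensor_id ::
    "('k::field \<Rightarrow> 'a \<Rightarrow> 'a::ab_group_add) \<Rightarrow> ('a \<Rightarrow> (('a \<times> 'a) \<Rightarrow>\<^sub>0 'k) set) \<Rightarrow>
      (('a \<times> 'a) \<Rightarrow>\<^sub>0 'k) set \<Rightarrow> (('a \<times> 'a \<times> 'a) \<Rightarrow>\<^sub>0 'k) set"
  where "comult_tensor_id s Delta X =
    free_lift free_scale
      (\<lambda>(x, y). free_lift free_scale (\<lambda>(u, v). Poly_Mapping.single (u, v, y) 1) (rep2 (Delta x)))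
      (rep2 X) +o null3 s"

text \<open>The map \<open>id \<otimes> \<Delta> : A \<otimes> A \<rightarrow> A \<otimes> A \<otimes> A\<close>.\<close>
definition id_tensor_comult ::
    "('k::field \<Rightarrow> 'a \<Rightarrow> 'a::ab_group_add) \<Rightarrow> ('a \<Rightarrow> (('a \<times> 'a) \<Rightarrow>\<^sub>0 'k) set) \<Rightarrow>
      (('a \<times> 'a) \<Rightarrow>\<^sub>0 'k) set \<Rightarrow> (('a \<times> 'a \<times> 'a) \<Rightarrow>\<^sub>0 'k) set"
  where "id_tensor_comult s Delta X =
    free_lift free_scale
      (\<lambda>(x, y). free_lift free_scale (\<lambda>(u, v). Poly_Mapping.single (x, u, v) 1) (rep2 (Delta y)))
      (rep2 X) +o null3 s"

section \<open>Infinitesimal bialgebras\<close>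

locale associative_algebra = vector_space scale
  for scale :: "'k::field \<Rightarrow> 'a::ab_group_add \<Rightarrow> 'a" +
  fixes mu :: "'a \<Rightarrow> 'a \<Rightarrow> 'a"
  assumes mu_linear_left: "Vector_Spaces.linear scale scale (\<lambda>a. mu a b)"
    and mu_linear_right: "Vector_Spaces.linear scale scale (\<lambda>b. mu a b)"
    and mu_assoc: "mu (mu a b) c = mu a (mu b c)"

locale coassociative_coalgebra = vector_space scale
  for scale :: "'k::field \<Rightarrow> 'a::ab_group_add \<Rightarrow> 'a" +
  fixes Delta :: "'a \<Rightarrow> (('a \<times> 'a) \<Rightarrow>\<^sub>0 'k) set"
  assumes Delta_in_tensor2: "Delta a \<in> tensor2 scale"
    and Delta_add: "Delta (a + b) = Delta a + Delta b"
    and Delta_scale: "Delta (scale c a) = free_scale c ` Delta a + null2 scale"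
    and Delta_coassoc:
      "comult_tensor_id scale Delta (Delta a) = id_tensor_comult scale Delta (Delta a)"

text \<open>The compatibility condition is \<open>\<Delta>(ab) = a b\<^sub>1 \<otimes> b\<^sub>2 + a\<^sub>1 \<otimes> a\<^sub>2 b\<close>.\<close>

locale infinitesimal_bialgebra =
  associative_algebra scale mu + coassociative_coalgebra scale Delta
  for scale :: "'k::field \<Rightarrow> 'a::ab_group_add \<Rightarrow> 'a" and mu Delta +
  assumes Delta_mu: "Delta (mu a b) =
    tensor_map scale (\<lambda>x. mu a x) id (Delta b) + tensor_map scale id (\<lambda>y. mu y b) (Delta a)"

definition convolution ::
    "('k::field \<Rightarrow> 'a \<Rightarrow> 'a::ab_group_add) \<Rightarrow> ('a \<Rightarrow> 'a \<Rightarrow> 'a) \<Rightarrow>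
      ('a \<Rightarrow> (('a \<times> 'a) \<Rightarrow>\<^sub>0 'k) set) \<Rightarrow> ('a \<Rightarrow> 'a) \<Rightarrow> ('a \<Rightarrow> 'a) \<Rightarrow> ('a \<Rightarrow> 'a)"
  where "convolution s mu Delta T S = tensor_mult s mu \<circ> tensor_map s T S \<circ> Delta"

section \<open>Independence of representatives\<close>

lemma subspace_null2: "free.subspace (null2 s)"
  unfolding null2_def by simp

lemma subspace_null3: "free.subspace (null3 s)"
  unfolding null3_def by simp

lemma null3_relators:
  "Poly_Mapping.single (x + x', y, z) 1 - Poly_Mapping.single (x, y, z) 1
    - Poly_Mapping.single (x', y, z) 1 \<in> null3 s"
  "Poly_Mapping.single (x, y + y', z) 1 - Poly_Mapping.single (x, y, z) 1
    - Poly_Mapping.single (x, y', z) 1 \<in> null3 s"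
  "Poly_Mapping.single (x, y, z + z') 1 - Poly_Mapping.single (x, y, z) 1
    - Poly_Mapping.single (x, y, z') 1 \<in> null3 s"
  "Poly_Mapping.single (s c x, y, z) 1 - Poly_Mapping.single (x, y, z) c \<in> null3 s"
  "Poly_Mapping.single (x, s c y, z) 1 - Poly_Mapping.single (x, y, z) c \<in> null3 s"
  "Poly_Mapping.single (x, y, s c z) 1 - Poly_Mapping.single (x, y, z) c \<in> null3 s"
  unfolding null3_def by ((rule free.span_base, fast))+

lemma coset_eq_iff:
  assumes "free.subspace N"
  shows "f +o N = g +o N \<longleftrightarrow> f - g \<in> N"
proof
  assume "f +o N = g +o N"
  moreover have "f \<in> f +o N"
    using free.subspace_0[OF assms] by (force simp: elt_set_plus_def)
  ultimately show "f - g \<in> N" by (auto simp: elt_set_plus_def)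
next
  have *: "f +o N \<subseteq> g +o N" if "f - g \<in> N" for f g
  proof
    fix h assume "h \<in> f +o N"
    then obtain n where "n \<in> N" "h = f + n" by (auto simp: elt_set_plus_def)
    then have "h = g + ((f - g) + n)" "(f - g) + n \<in> N"
      using that assms free.subspace_add by auto
    then show "h \<in> g +o N" unfolding elt_set_plus_def by blast
  qed
  assume "f - g \<in> N"
  moreover from this have "g - f \<in> N"
    using free.subspace_neg[OF assms] by fastforce
  ultimately show "f +o N = g +o N" using * by blast
qed

lemma rep2_coset: "rep2 (f +o null2 s) - f \<in> null2 s"
proof -
  have "f \<in> f +o null2 s"
    using free.subspace_0[OF subspace_null2] by (force simp: elt_set_plus_def)
  then have "rep2 (f +o null2 s) \<in> f +o null2 s" unfolding rep2_def by (rule someI)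
  then show ?thesis by (auto simp: elt_set_plus_def)
qed

lemma free_lift_null2:
  assumes v: "vector_space s'" and N: "module.subspace s' N"
    and "\<And>a a' b. g (a + a', b) - g (a, b) - g (a', b) \<in> N"
    and "\<And>a b b'. g (a, b + b') - g (a, b) - g (a, b') \<in> N"
    and "\<And>c a b. g (s c a, b) - s' c (g (a, b)) \<in> N"
    and "\<And>c a b. g (a, s c b) - s' c (g (a, b)) \<in> N"
    and f: "f \<in> null2 s"
  shows "free_lift s' g f \<in> N"
proof -
  interpret v: vector_space s' by fact
  interpret l: Vector_Spaces.linear free_scale s' "free_lift s' g" by (rule linear_free_lift[OF v])
  show ?thesis
    using f unfolding null2_def
    by (induction rule: free.span_induct_alt)
      (auto simp: l.zero l.add l.diff l.scale free_lift_single[OF v] assms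
        intro!: v.subspace_0[OF N] v.subspace_add[OF N] v.subspace_scale[OF N])
qed

lemma free_lift_rep2:
  assumes v: "vector_space s'" and N: "module.subspace s' N"
    and "\<And>a a' b. g (a + a', b) - g (a, b) - g (a', b) \<in> N"
    and "\<And>a b b'. g (a, b + b') - g (a, b) - g (a, b') \<in> N"
    and "\<And>c a b. g (s c a, b) - s' c (g (a, b)) \<in> N"
    and "\<And>c a b. g (a, s c b) - s' c (g (a, b)) \<in> N"
  shows "free_lift s' g (rep2 (f +o null2 s)) - free_lift s' g f \<in> N"
proof -
  interpret l: Vector_Spaces.linear free_scale s' "free_lift s' g" by (rule linear_free_lift[OF v])
  show ?thesis
    unfolding l.diff[symmetric] by (rule free_lift_null2[OF assms rep2_coset])
qed

lemma (in associative_algebra) tensor_mult_coset: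
  "tensor_mult scale mu (f +o null2 scale) = free_lift scale (\<lambda>(x, y). mu x y) f"
proof -
  interpret l: Vector_Spaces.linear scale scale "\<lambda>a. mu a b" for b by (rule mu_linear_left)
  interpret r: Vector_Spaces.linear scale scale "\<lambda>b. mu a b" for a by (rule mu_linear_right)
  have "tensor_mult scale mu (f +o null2 scale) - free_lift scale (\<lambda>(x, y). mu x y) f \<in> {0}"
    unfolding tensor_mult_def
    by (rule free_lift_rep2[OF vector_space_axioms])
      (simp_all add: l.add r.add l.scale r.scale)
  then show ?thesis by simp
qed

lemma tensor_map_coset:
  assumes "Vector_Spaces.linear s s T" "Vector_Spaces.linear s s S"
  shows "tensor_map s T S (f +o null2 s) =
    free_lift free_scale (\<lambda>(x, y). Poly_Mapping.single (T x, S y) 1) f +o null2 s"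
proof -
  interpret T: Vector_Spaces.linear s s T by fact
  interpret S: Vector_Spaces.linear s s S by fact
  show ?thesis
    unfolding tensor_map_def coset_eq_iff[OF subspace_null2]
    by (rule free_lift_rep2[OF free.vector_space_axioms subspace_null2];
        simp add: T.add T.scale S.add S.scale; unfold null2_def; rule free.span_base; blast)
qed

context coassociative_coalgebra
begin

lemma Delta_coset:
  assumes "h \<in> Delta a"
  shows "Delta a = h +o null2 scale"
proof -
  obtain f where f: "Delta a = f +o null2 scale"
    using Delta_in_tensor2[of a] by (auto simp: tensor2_def)
  moreover from this assms have "f - h \<in> null2 scale"
    using free.subspace_neg[OF subspace_null2] by (fastforce simp: elt_set_plus_def)
  ultimately show ?thesis by (simp add: coset_eq_iff subspace_null2)
qed

lemma rep2_Delta: "rep2 (Delta a) \<in> Delta a"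
proof -
  obtain f where f: "Delta a = f +o null2 scale"
    using Delta_in_tensor2[of a] by (auto simp: tensor2_def)
  have "f \<in> Delta a"
    using free.subspace_0[OF subspace_null2] by (force simp: f elt_set_plus_def)
  then show ?thesis unfolding rep2_def by (rule someI)
qed

lemma rep2_Delta_add:
  "rep2 (Delta (a + b)) - rep2 (Delta a) - rep2 (Delta b) \<in> null2 scale"
proof -
  have "rep2 (Delta a) + rep2 (Delta b) \<in> Delta (a + b)"
    unfolding Delta_add by (intro set_plus_intro rep2_Delta)
  from Delta_coset[OF this] rep2_coset show ?thesis by (simp add: diff_diff_eq)
qed

lemma rep2_Delta_scale:
  "rep2 (Delta (scale c a)) - free_scale c (rep2 (Delta a)) \<in> null2 scale"
proof -
  have "free_scale c (rep2 (Delta a)) + 0 \<in> Delta (scale c a)"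
    unfolding Delta_scale
    by (intro set_plus_intro imageI rep2_Delta free.subspace_0 subspace_null2)
  from Delta_coset[OF this] rep2_coset show ?thesis by simp
qed

lemma comult_tensor_id_coset:
  "comult_tensor_id scale Delta (f +o null2 scale) =
    free_lift free_scale
      (\<lambda>(x, y). free_lift free_scale (\<lambda>(u, v). Poly_Mapping.single (u, v, y) 1) (rep2 (Delta x)))
      f +o null3 scale"
proof -
  define H :: "'a \<Rightarrow> (('a \<times> 'a) \<Rightarrow>\<^sub>0 'k) \<Rightarrow> (('a \<times> 'a \<times> 'a) \<Rightarrow>\<^sub>0 'k)"
    where "H y = free_lift free_scale (\<lambda>(u, v). Poly_Mapping.single (u, v, y) 1)" for y
  interpret H: Vector_Spaces.linear free_scale free_scale "H y" for y
    unfolding H_def by (rule linear_free_lift[OF free.vector_space_axioms])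
  have null: "H y f \<in> null3 scale" if "f \<in> null2 scale" for f y
    unfolding H_def
    by (rule free_lift_null2[OF free.vector_space_axioms subspace_null3 _ _ _ _ that];
        simp add: null3_relators)
  have H_add: "H (y + y') f - H y f - H y' f \<in> null3 scale" for y y' f
    unfolding H_def free_lift_def sum_subtractf[symmetric] free.scale_right_diff_distrib[symmetric]
    by (intro free.subspace_sum[OF subspace_null3] free.subspace_scale[OF subspace_null3])
      (auto simp: null3_relators)
  have H_scale: "H (scale c y) f - free_scale c (H y f) \<in> null3 scale" for c y f
  proof -
    have "free_scale c (H y f) = free_lift free_scale (\<lambda>(u, v). Poly_Mapping.single (u, v, y) c) f"
      unfolding H_def free_lift_def free.scale_sum_right
      by (intro sum.cong refl) (auto simp: mult.commute)
    then show ?thesis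
      unfolding H_def free_lift_def
      by (simp only: sum_subtractf[symmetric] free.scale_right_diff_distrib[symmetric])
        (intro free.subspace_sum[OF subspace_null3] free.subspace_scale[OF subspace_null3],
         auto simp: null3_relators)
  qed
  have rep_add: "H y (rep2 (Delta (a + b))) - H y (rep2 (Delta a)) - H y (rep2 (Delta b)) \<in> null3 scale"
    for y a b unfolding H.diff[symmetric] by (rule null[OF rep2_Delta_add])
  have rep_scale: "H y (rep2 (Delta (scale c a))) - free_scale c (H y (rep2 (Delta a))) \<in> null3 scale"
    for y c a unfolding H.diff[symmetric] H.scale[symmetric] by (rule null[OF rep2_Delta_scale])
  have "free_lift free_scale (\<lambda>(x, y). H y (rep2 (Delta x))) (rep2 (f +o null2 scale))
      - free_lift free_scale (\<lambda>(x, y). H y (rep2 (Delta x))) f \<in> null3 scale"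
    by (rule free_lift_rep2[OF free.vector_space_axioms subspace_null3])
      (simp_all add: H_add H_scale rep_add rep_scale)
  then show ?thesis
    unfolding comult_tensor_id_def coset_eq_iff[OF subspace_null3] H_def .
qed

lemma id_tensor_comult_coset:
  "id_tensor_comult scale Delta (f +o null2 scale) =
    free_lift free_scale
      (\<lambda>(x, y). free_lift free_scale (\<lambda>(u, v). Poly_Mapping.single (x, u, v) 1) (rep2 (Delta y)))
      f +o null3 scale"
proof -
  define H :: "'a \<Rightarrow> (('a \<times> 'a) \<Rightarrow>\<^sub>0 'k) \<Rightarrow> (('a \<times> 'a \<times> 'a) \<Rightarrow>\<^sub>0 'k)"
    where "H y = free_lift free_scale (\<lambda>(u, v). Poly_Mapping.single (y, u, v) 1)" for y
  interpret H: Vector_Spaces.linear free_scale free_scale "H y" for y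
    unfolding H_def by (rule linear_free_lift[OF free.vector_space_axioms])
  have null: "H y f \<in> null3 scale" if "f \<in> null2 scale" for f y
    unfolding H_def
    by (rule free_lift_null2[OF free.vector_space_axioms subspace_null3 _ _ _ _ that];
        simp add: null3_relators)
  have H_add: "H (y + y') f - H y f - H y' f \<in> null3 scale" for y y' f
    unfolding H_def free_lift_def sum_subtractf[symmetric] free.scale_right_diff_distrib[symmetric]
    by (intro free.subspace_sum[OF subspace_null3] free.subspace_scale[OF subspace_null3])
      (auto simp: null3_relators)
  have H_scale: "H (scale c y) f - free_scale c (H y f) \<in> null3 scale" for c y f
  proof -
    have "free_scale c (H y f) = free_lift free_scale (\<lambda>(u, v). Poly_Mapping.single (y, u, v) c) f"
      unfolding H_def free_lift_def free.scale_sum_right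
      by (intro sum.cong refl) (auto simp: mult.commute)
    then show ?thesis
      unfolding H_def free_lift_def
      by (simp only: sum_subtractf[symmetric] free.scale_right_diff_distrib[symmetric])
        (intro free.subspace_sum[OF subspace_null3] free.subspace_scale[OF subspace_null3],
         auto simp: null3_relators)
  qed
  have rep_add: "H y (rep2 (Delta (a + b))) - H y (rep2 (Delta a)) - H y (rep2 (Delta b)) \<in> null3 scale"
    for y a b unfolding H.diff[symmetric] by (rule null[OF rep2_Delta_add])
  have rep_scale: "H y (rep2 (Delta (scale c a))) - free_scale c (H y (rep2 (Delta a))) \<in> null3 scale"
    for y c a unfolding H.diff[symmetric] H.scale[symmetric] by (rule null[OF rep2_Delta_scale])
  have "free_lift free_scale (\<lambda>(x, y). H x (rep2 (Delta y))) (rep2 (f +o null2 scale))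
      - free_lift free_scale (\<lambda>(x, y). H x (rep2 (Delta y))) f \<in> null3 scale"
    by (rule free_lift_rep2[OF free.vector_space_axioms subspace_null3])
      (simp_all add: H_add H_scale rep_add rep_scale)
  then show ?thesis
    unfolding id_tensor_comult_def coset_eq_iff[OF subspace_null3] H_def .
qed

end

section \<open>Quadri-algebras\<close>

locale quadri_operations =
  fixes se :: "'q::plus \<Rightarrow> 'q \<Rightarrow> 'q"  (infixl \<open>\<searrow>\<close> 70)
    and ne :: "'q \<Rightarrow> 'q \<Rightarrow> 'q"  (infixl \<open>\<nearrow>\<close> 70)
    and nw :: "'q \<Rightarrow> 'q \<Rightarrow> 'q"  (infixl \<open>\<nwarrow>\<close> 70)
    and sw :: "'q \<Rightarrow> 'q \<Rightarrow> 'q"  (infixl \<open>\<swarrow>\<close> 70)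
begin

definition quadri_succ  (infixl \<open>\<succ>\<close> 70) where "x \<succ> y = x \<nearrow> y + x \<searrow> y"
definition quadri_prec  (infixl \<open>\<prec>\<close> 70) where "x \<prec> y = x \<nwarrow> y + x \<swarrow> y"
definition quadri_vee  (infixl \<open>\<curlyvee>\<close> 70) where "x \<curlyvee> y = x \<searrow> y + x \<swarrow> y"
definition quadri_wedge  (infixl \<open>\<curlywedge>\<close> 70) where "x \<curlywedge> y = x \<nearrow> y + x \<nwarrow> y"
definition quadri_star  (infixl \<open>\<star>\<close> 70)
  where "x \<star> y = x \<searrow> y + x \<nearrow> y + x \<nwarrow> y + x \<swarrow> y"

end

text \<open>The operations on the vector space \<open>Q\<close>, a subspace of an ambient type, are only
  constrained on \<open>Q\<close>.\<close>

definition bilinear_on :: "('k \<Rightarrow> 'q \<Rightarrow> 'q::plus) \<Rightarrow> 'q set \<Rightarrow> ('q \<Rightarrow> 'q \<Rightarrow> 'q) \<Rightarrow> bool"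
  where "bilinear_on s Q f \<longleftrightarrow>
    (\<forall>x\<in>Q. \<forall>y\<in>Q. f x y \<in> Q) \<and>
    (\<forall>x\<in>Q. \<forall>x'\<in>Q. \<forall>y\<in>Q. f (x + x') y = f x y + f x' y) \<and>
    (\<forall>x\<in>Q. \<forall>y\<in>Q. \<forall>y'\<in>Q. f x (y + y') = f x y + f x y') \<and>
    (\<forall>c. \<forall>x\<in>Q. \<forall>y\<in>Q. f (s c x) y = s c (f x y)) \<and>
    (\<forall>c. \<forall>x\<in>Q. \<forall>y\<in>Q. f x (s c y) = s c (f x y))"

locale quadri_algebra = vector_space scale + quadri_operations se ne nw sw
  for scale :: "'k::field \<Rightarrow> 'q::ab_group_add \<Rightarrow> 'q"
    and Q :: "'q set"
    and se :: "'q \<Rightarrow> 'q \<Rightarrow> 'q"  (infixl \<open>\<searrow>\<close> 70)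
    and ne :: "'q \<Rightarrow> 'q \<Rightarrow> 'q"  (infixl \<open>\<nearrow>\<close> 70)
    and nw :: "'q \<Rightarrow> 'q \<Rightarrow> 'q"  (infixl \<open>\<nwarrow>\<close> 70)
    and sw :: "'q \<Rightarrow> 'q \<Rightarrow> 'q"  (infixl \<open>\<swarrow>\<close> 70) +
  assumes subspace_carrier: "subspace Q"
    and bilinear_se: "bilinear_on scale Q (\<searrow>)"
    and bilinear_ne: "bilinear_on scale Q (\<nearrow>)"
    and bilinear_nw: "bilinear_on scale Q (\<nwarrow>)"
    and bilinear_sw: "bilinear_on scale Q (\<swarrow>)"
    and quadri_identities:
      "\<lbrakk>x \<in> Q; y \<in> Q; z \<in> Q\<rbrakk> \<Longrightarrow> (x \<nwarrow> y) \<nwarrow> z = x \<nwarrow> (y \<star> z)"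
      "\<lbrakk>x \<in> Q; y \<in> Q; z \<in> Q\<rbrakk> \<Longrightarrow> (x \<nearrow> y) \<nwarrow> z = x \<nearrow> (y \<prec> z)"
      "\<lbrakk>x \<in> Q; y \<in> Q; z \<in> Q\<rbrakk> \<Longrightarrow> (x \<curlywedge> y) \<nearrow> z = x \<nearrow> (y \<succ> z)"
      "\<lbrakk>x \<in> Q; y \<in> Q; z \<in> Q\<rbrakk> \<Longrightarrow> (x \<swarrow> y) \<nwarrow> z = x \<swarrow> (y \<curlywedge> z)"
      "\<lbrakk>x \<in> Q; y \<in> Q; z \<in> Q\<rbrakk> \<Longrightarrow> (x \<searrow> y) \<nwarrow> z = x \<searrow> (y \<nwarrow> z)"
      "\<lbrakk>x \<in> Q; y \<in> Q; z \<in> Q\<rbrakk> \<Longrightarrow> (x \<curlyvee> y) \<nearrow> z = x \<searrow> (y \<nearrow> z)"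
      "\<lbrakk>x \<in> Q; y \<in> Q; z \<in> Q\<rbrakk> \<Longrightarrow> (x \<prec> y) \<swarrow> z = x \<swarrow> (y \<curlyvee> z)"
      "\<lbrakk>x \<in> Q; y \<in> Q; z \<in> Q\<rbrakk> \<Longrightarrow> (x \<succ> y) \<swarrow> z = x \<searrow> (y \<swarrow> z)"
      "\<lbrakk>x \<in> Q; y \<in> Q; z \<in> Q\<rbrakk> \<Longrightarrow> (x \<star> y) \<searrow> z = x \<searrow> (y \<searrow> z)"

end

(* The operators L T = id * T and R T = T * id on End(A) commute because convolution is
   associative, and the compatibility of the product with the coproduct makes both of them
   Rota-Baxter operators of weight zero for composition.  Any commuting pair of Rota-Baxter
   operators on an associative algebra yields a quadri-algebra. *)

theory Submission
  imports Defs
begin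

section \<open>Commuting Rota-Baxter operators\<close>

text \<open>The laws are required only on a subspace \<open>Q\<close> of an ambient type, because
  the intended elements, the linear endomorphisms, are a proper part of the type of all
  functions.\<close>

locale commuting_rota_baxter = vector_space scale
  for scale :: "'k::field \<Rightarrow> 'q::ab_group_add \<Rightarrow> 'q" +
  fixes Q :: "'q set"
    and m :: "'q \<Rightarrow> 'q \<Rightarrow> 'q"  (infixl \<open>\<cdot>\<close> 70)
    and L R :: "'q \<Rightarrow> 'q"
  assumes subspace_Q: "subspace Q"
    and bilinear_m: "bilinear_on scale Q (\<cdot>)"
    and m_assoc: "\<lbrakk>x \<in> Q; y \<in> Q; z \<in> Q\<rbrakk> \<Longrightarrow> (x \<cdot> y) \<cdot> z = x \<cdot> (y \<cdot> z)"
    and L_closed: "x \<in> Q \<Longrightarrow> L x \<in> Q"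
    and R_closed: "x \<in> Q \<Longrightarrow> R x \<in> Q"
    and L_add: "\<lbrakk>x \<in> Q; y \<in> Q\<rbrakk> \<Longrightarrow> L (x + y) = L x + L y"
    and R_add: "\<lbrakk>x \<in> Q; y \<in> Q\<rbrakk> \<Longrightarrow> R (x + y) = R x + R y"
    and L_scale: "x \<in> Q \<Longrightarrow> L (scale c x) = scale c (L x)"
    and R_scale: "x \<in> Q \<Longrightarrow> R (scale c x) = scale c (R x)"
    and L_R: "x \<in> Q \<Longrightarrow> L (R x) = R (L x)"
    and rota_baxter_L: "\<lbrakk>x \<in> Q; y \<in> Q\<rbrakk> \<Longrightarrow> L x \<cdot> L y = L (L x \<cdot> y + x \<cdot> L y)"
    and rota_baxter_R: "\<lbrakk>x \<in> Q; y \<in> Q\<rbrakk> \<Longrightarrow> R x \<cdot> R y = R (R x \<cdot> y + x \<cdot> R y)"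
begin

lemma m_closed: "\<lbrakk>x \<in> Q; y \<in> Q\<rbrakk> \<Longrightarrow> x \<cdot> y \<in> Q"
  and m_add_left: "\<lbrakk>x \<in> Q; x' \<in> Q; y \<in> Q\<rbrakk> \<Longrightarrow> (x + x') \<cdot> y = x \<cdot> y + x' \<cdot> y"
  and m_add_right: "\<lbrakk>x \<in> Q; y \<in> Q; y' \<in> Q\<rbrakk> \<Longrightarrow> x \<cdot> (y + y') = x \<cdot> y + x \<cdot> y'"
  and m_scale_left: "\<lbrakk>x \<in> Q; y \<in> Q\<rbrakk> \<Longrightarrow> scale c x \<cdot> y = scale c (x \<cdot> y)"
  and m_scale_right: "\<lbrakk>x \<in> Q; y \<in> Q\<rbrakk> \<Longrightarrow> x \<cdot> scale c y = scale c (x \<cdot> y)"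
  using bilinear_m unfolding bilinear_on_def by blast+

lemmas Q_closed = m_closed L_closed R_closed
  subspace_add[OF subspace_Q] subspace_scale[OF subspace_Q]

lemmas Q_linear = m_add_left m_add_right m_scale_left m_scale_right L_add R_add L_scale R_scale

text \<open>Instances of \<open>rota_baxter_L\<close> with \<open>R x\<close> or \<open>R y\<close>
  as an argument, where \<open>L (R x)\<close> is brought to the normal form
  \<open>R (L x)\<close>.\<close>

lemma rota_baxter_mixed:
  assumes "x \<in> Q" "y \<in> Q"
  shows "R (L x) \<cdot> L y = L (R (L x) \<cdot> y + R x \<cdot> L y)"
    and "L x \<cdot> R (L y) = L (L x \<cdot> R y + x \<cdot> R (L y))"
  using rota_baxter_L[of "R x" y] rota_baxter_L[of x "R y"] assms by (simp_all add: L_R R_closed)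

text \<open>\<open>rota_baxter_R\<close> leaves two products inside \<open>R\<close>, and each of
  them is \<open>L\<close> of two terms by \<open>rota_baxter_mixed\<close>. The four summands stand
  in the order of \<open>quadri_star\<close>, so \<open>R \<circ> L\<close> carries the star product
  to \<open>m\<close>.\<close>

lemma rota_baxter_R_L:
  assumes "x \<in> Q" "y \<in> Q"
  shows "R (L x) \<cdot> R (L y) = R (L (R (L x) \<cdot> y + L x \<cdot> R y + x \<cdot> R (L y) + R x \<cdot> L y))"
  using assms
  by (simp add: rota_baxter_R rota_baxter_mixed Q_closed Q_linear ac_simps)

text \<open>Both sides of each identity reduce to one product of \<open>x\<close>, \<open>y\<close>,
  \<open>z\<close> in which \<open>L\<close> acts on exactly two factors and \<open>R\<close> acts
  on exactly two factors. The factor skipped by \<open>L\<close> and the factor skipped by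
  \<open>R\<close> vary independently, which accounts for the nine identities.\<close>

sublocale quadri_algebra scale Q
  "\<lambda>x y. R (L x) \<cdot> y" "\<lambda>x y. L x \<cdot> R y" "\<lambda>x y. x \<cdot> R (L y)" "\<lambda>x y. R x \<cdot> L y"
proof -
  interpret quadri_operations
    "\<lambda>x y. R (L x) \<cdot> y" "\<lambda>x y. L x \<cdot> R y" "\<lambda>x y. x \<cdot> R (L y)" "\<lambda>x y. R x \<cdot> L y" .
  note ops = quadri_succ_def quadri_prec_def quadri_vee_def quadri_wedge_def quadri_star_def
  text \<open>The identities are proved by contracting sums to products.  Expanding the products
    instead would compete with associativity, and \<open>rota_baxter_right\<close> repeats the rules with
    swapped summands because the derived operations order theirs differently.\<close>
  note rota_baxter_left = rota_baxter_L[symmetric] rota_baxter_R[symmetric]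
    rota_baxter_mixed[symmetric] rota_baxter_R_L[symmetric]
  note rota_baxter_right =
    rota_baxter_L[symmetric, unfolded add.commute[of "L x \<cdot> y" for x y]]
    rota_baxter_R[symmetric, unfolded add.commute[of "R x \<cdot> y" for x y]]
    rota_baxter_mixed[symmetric, unfolded add.commute[of "R (L x) \<cdot> y" for x y]
      add.commute[of "L x \<cdot> R y" for x y]]
  show "quadri_algebra scale Q
    (\<lambda>x y. R (L x) \<cdot> y) (\<lambda>x y. L x \<cdot> R y) (\<lambda>x y. x \<cdot> R (L y)) (\<lambda>x y. R x \<cdot> L y)"
  proof (intro quadri_algebra.intro quadri_algebra_axioms.intro vector_space_axioms subspace_Q)
    show "bilinear_on scale Q (\<lambda>x y. R (L x) \<cdot> y)" "bilinear_on scale Q (\<lambda>x y. L x \<cdot> R y)"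
      "bilinear_on scale Q (\<lambda>x y. x \<cdot> R (L y))" "bilinear_on scale Q (\<lambda>x y. R x \<cdot> L y)"
      by (simp_all add: bilinear_on_def Q_closed Q_linear)
  qed (simp_all add: ops rota_baxter_left rota_baxter_right m_assoc Q_closed)
qed

end

section \<open>Sweedler sums\<close>

lemma (in vector_space) linear_free_lift_commute:
  assumes "Vector_Spaces.linear s scale \<phi>"
  shows "\<phi> (free_lift s g f) = free_lift scale (\<lambda>x. \<phi> (g x)) f"
proof -
  interpret \<phi>: Vector_Spaces.linear s scale \<phi> by fact
  show ?thesis by (simp add: free_lift_def \<phi>.sum \<phi>.scale)
qed

lemmas (in vector_space) free_lift_free_lift =
  linear_free_lift_commute[OF linear_free_lift[OF vector_space_axioms]]

text \<open>A trilinear map kills all six families of relators, hence descends to the threefold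
  tensor power. This allows coassociativity, an equation of cosets, to be evaluated.\<close>

lemma free_lift_null3:
  assumes v: "vector_space s'"
    and lin: "\<And>y z. Vector_Spaces.linear s s' (\<lambda>x. h x y z)"
      "\<And>x z. Vector_Spaces.linear s s' (\<lambda>y. h x y z)"
      "\<And>x y. Vector_Spaces.linear s s' (\<lambda>z. h x y z)"
    and f: "f \<in> null3 s"
  shows "free_lift s' (\<lambda>(x, y, z). h x y z) f = 0"
proof -
  interpret v: vector_space s' by fact
  interpret l: Vector_Spaces.linear free_scale s' "free_lift s' (\<lambda>(x, y, z). h x y z)"
    by (rule linear_free_lift[OF v])
  interpret h1: Vector_Spaces.linear s s' "\<lambda>x. h x y z" for y z by (rule lin)
  interpret h2: Vector_Spaces.linear s s' "\<lambda>y. h x y z" for x z by (rule lin)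
  interpret h3: Vector_Spaces.linear s s' "\<lambda>z. h x y z" for x y by (rule lin)
  show ?thesis
    using f unfolding null3_def
    by (induction rule: free.span_induct_alt)
      (auto simp: l.zero l.add l.diff l.scale free_lift_single[OF v]
        h1.add h2.add h3.add h1.scale h2.scale h3.scale)
qed

context coassociative_coalgebra
begin

text \<open>The Sweedler expression g(a_1, a_2), computed on a chosen representative. Rules that
  vary only \<open>g\<close> or apply a linear map outside hold for every \<open>g\<close>; rules
  that vary \<open>a\<close> need \<open>g\<close> bilinear.\<close>

definition sweedler :: "('a \<Rightarrow> 'a \<Rightarrow> 'a) \<Rightarrow> 'a \<Rightarrow> 'a"
  where "sweedler g a = free_lift scale (\<lambda>(x, y). g x y) (rep2 (Delta a))"

lemma sweedler_add: "sweedler (\<lambda>x y. g x y + h x y) a = sweedler g a + sweedler h a"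
  by (simp add: sweedler_def free_lift_def scale_right_distrib sum.distrib case_prod_unfold)

lemma linear_sweedler_commute:
  assumes "Vector_Spaces.linear scale scale \<phi>"
  shows "\<phi> (sweedler g a) = sweedler (\<lambda>x y. \<phi> (g x y)) a"
  by (simp add: sweedler_def linear_free_lift_commute[OF assms] case_prod_unfold)

lemma free_lift_null2_bilinear:
  assumes lin: "\<And>y. Vector_Spaces.linear scale scale (\<lambda>x. g x y)"
    "\<And>x. Vector_Spaces.linear scale scale (\<lambda>y. g x y)"
    and f: "f \<in> null2 scale"
  shows "free_lift scale (\<lambda>(x, y). g x y) f = 0"
proof -
  interpret g1: Vector_Spaces.linear scale scale "\<lambda>x. g x y" for y by (rule lin)
  interpret g2: Vector_Spaces.linear scale scale "\<lambda>y. g x y" for x by (rule lin)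
  \<comment> \<open>With \<open>{0}\<close> as the subspace, the congruence in
    \<open>free_lift_null2\<close> becomes an equality.\<close>
  have "free_lift scale (\<lambda>(x, y). g x y) f \<in> {0}"
    by (rule free_lift_null2[OF vector_space_axioms _ _ _ _ _ f])
      (simp_all add: g1.add g2.add g1.scale g2.scale)
  then show ?thesis by simp
qed

text \<open>Bilinear maps factor through the tensor product, so any representative may replace the
  chosen one; \<open>sweedler_mu\<close> relies on this.\<close>

lemma sweedler_coset:
  assumes lin: "\<And>y. Vector_Spaces.linear scale scale (\<lambda>x. g x y)"
    "\<And>x. Vector_Spaces.linear scale scale (\<lambda>y. g x y)"
    and f: "Delta a = f +o null2 scale"
  shows "sweedler g a = free_lift scale (\<lambda>(x, y). g x y) f"
proof -
  interpret l: Vector_Spaces.linear free_scale scale "free_lift scale (\<lambda>(x, y). g x y)"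
    by (rule linear_free_lift[OF vector_space_axioms])
  show ?thesis
    using free_lift_null2_bilinear[OF lin rep2_coset[of f scale]]
    by (simp add: sweedler_def f l.diff)
qed

lemma Delta_rep2: "Delta a = rep2 (Delta a) +o null2 scale"
  by (rule Delta_coset[OF rep2_Delta])

text \<open>The chosen representatives are additive and homogeneous only modulo
  \<open>null2\<close>, and a bilinear \<open>g\<close> annihilates the error.\<close>

lemma linear_sweedler:
  assumes lin: "\<And>y. Vector_Spaces.linear scale scale (\<lambda>x. g x y)"
    "\<And>x. Vector_Spaces.linear scale scale (\<lambda>y. g x y)"
  shows "Vector_Spaces.linear scale scale (sweedler g)"
proof -
  interpret l: Vector_Spaces.linear free_scale scale "free_lift scale (\<lambda>(x, y). g x y)"
    by (rule linear_free_lift[OF vector_space_axioms])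
  show ?thesis
    using free_lift_null2_bilinear[OF lin rep2_Delta_add]
      free_lift_null2_bilinear[OF lin rep2_Delta_scale]
    by unfold_locales (simp_all add: sweedler_def l.add l.diff l.scale algebra_simps)
qed

text \<open>The trilinear \<open>h\<close> is applied to both sides of the coassociativity
  axiom.\<close>

lemma sweedler_coassoc:
  assumes lin: "\<And>y z. Vector_Spaces.linear scale scale (\<lambda>x. h x y z)"
      "\<And>x z. Vector_Spaces.linear scale scale (\<lambda>y. h x y z)"
      "\<And>x y. Vector_Spaces.linear scale scale (\<lambda>z. h x y z)"
  shows "sweedler (\<lambda>x z. sweedler (\<lambda>u v. h u v z) x) a = sweedler (\<lambda>x y. sweedler (h x) y) a"
proof -
  let ?H = "free_lift scale (\<lambda>(x, y, z). h x y z)"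
  interpret l: Vector_Spaces.linear free_scale scale ?H
    by (rule linear_free_lift[OF vector_space_axioms])
  let ?f = "rep2 (Delta a)"
  let ?l = "free_lift free_scale
      (\<lambda>(x, y). free_lift free_scale (\<lambda>(u, v). Poly_Mapping.single (u, v, y) 1) (rep2 (Delta x))) ?f"
  let ?r = "free_lift free_scale
      (\<lambda>(x, y). free_lift free_scale (\<lambda>(u, v). Poly_Mapping.single (x, u, v) 1) (rep2 (Delta y))) ?f"
  \<comment> \<open>Writing \<open>Delta a\<close> as the coset of its representative gives the two
    sides of coassociativity the explicit representatives \<open>?l\<close> and
    \<open>?r\<close>.\<close>
  have "?l +o null3 scale = ?r +o null3 scale"
    using Delta_coassoc[of a] comult_tensor_id_coset[of ?f] id_tensor_comult_coset[of ?f]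
    by (simp flip: Delta_rep2)
  then have "?l - ?r \<in> null3 scale"
    by (simp add: coset_eq_iff[OF subspace_null3])
  then have "?H ?l = ?H ?r"
    using free_lift_null3[OF vector_space_axioms lin, of "?l - ?r"] by (simp add: l.diff)
  then show ?thesis
    by (simp add: sweedler_def free_lift_free_lift case_prod_unfold
        free_lift_single[OF vector_space_axioms])
qed

end

section \<open>Convolution with the identity\<close>

context infinitesimal_bialgebra
begin

interpretation endo: vector_space_pair scale scale ..

text \<open>With composition unfolded, these work as introduction rules for the linearity of nested
  products in one variable.\<close>

lemmas linear_mu_left_comp = Vector_Spaces.linear_compose[OF _ mu_linear_left, unfolded comp_def]
lemmas linear_mu_right_comp = Vector_Spaces.linear_compose[OF _ mu_linear_right, unfolded comp_def]

text \<open>The compatibility of product and coproduct, seen through a bilinear map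
  \<open>g\<close>.\<close>

lemma sweedler_mu:
  assumes lin: "\<And>y. Vector_Spaces.linear scale scale (\<lambda>x. g x y)"
    "\<And>x. Vector_Spaces.linear scale scale (\<lambda>y. g x y)"
  shows "sweedler g (mu a b) =
    sweedler (\<lambda>x y. g (mu a x) y) b + sweedler (\<lambda>x y. g x (mu y b)) a"
proof -
  let ?G = "free_lift scale (\<lambda>(x, y). g x y)"
  interpret l: Vector_Spaces.linear free_scale scale ?G
    by (rule linear_free_lift[OF vector_space_axioms])
  let ?p = "free_lift free_scale (\<lambda>(x, y). Poly_Mapping.single (mu a x, id y) 1) (rep2 (Delta b))"
  let ?q = "free_lift free_scale (\<lambda>(x, y). Poly_Mapping.single (id x, mu y b) 1) (rep2 (Delta a))"
  \<comment> \<open>Each tensor map is a coset with an explicit representative, and the sum of the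
    two represents the sum of the cosets.\<close>
  have "?p + ?q \<in> Delta (mu a b)"
    unfolding Delta_mu tensor_map_def
    using free.subspace_0[OF subspace_null2]
    by (intro set_plus_intro) (force simp: elt_set_plus_def)+
  then have "sweedler g (mu a b) = ?G (?p + ?q)"
    by (intro sweedler_coset lin Delta_coset)
  then show ?thesis
    unfolding l.add
    by (simp add: sweedler_def free_lift_free_lift case_prod_unfold
        free_lift_single[OF vector_space_axioms])
qed

section \<open>Convolution as a Sweedler sum\<close>

abbreviation conv where "conv \<equiv> convolution scale mu Delta"

text \<open>Linearity of \<open>T\<close> and \<open>S\<close> makes \<open>tensor_map\<close>
  independent of the representative, so it can be computed on the one used by
  \<open>sweedler\<close>.\<close>

lemma conv_eq_sweedler:
  assumes "Vector_Spaces.linear scale scale T" "Vector_Spaces.linear scale scale S"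
  shows "conv T S = sweedler (\<lambda>x y. mu (T x) (S y))"
proof
  fix a
  have "conv T S a = tensor_mult scale mu (tensor_map scale T S (rep2 (Delta a) +o null2 scale))"
    by (simp add: convolution_def flip: Delta_rep2)
  then show "conv T S a = sweedler (\<lambda>x y. mu (T x) (S y)) a"
    by (simp add: tensor_map_coset[OF assms] tensor_mult_coset sweedler_def case_prod_unfold
        free_lift_free_lift free_lift_single[OF vector_space_axioms])
qed

lemma linear_conv:
  assumes "Vector_Spaces.linear scale scale T" "Vector_Spaces.linear scale scale S"
  shows "Vector_Spaces.linear scale scale (conv T S)"
  unfolding conv_eq_sweedler[OF assms]
  by (intro linear_sweedler linear_mu_left_comp linear_mu_right_comp assms)

lemma conv_id_left:
  "Vector_Spaces.linear scale scale T \<Longrightarrow> conv id T = sweedler (\<lambda>x y. mu x (T y))"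
  by (simp add: conv_eq_sweedler linear_id)

lemma conv_id_right:
  "Vector_Spaces.linear scale scale T \<Longrightarrow> conv T id = sweedler (\<lambda>x y. mu (T x) y)"
  by (simp add: conv_eq_sweedler linear_id)

lemma conv_assoc:
  assumes T: "Vector_Spaces.linear scale scale T"
    and S: "Vector_Spaces.linear scale scale S"
    and U: "Vector_Spaces.linear scale scale U"
  shows "conv (conv T S) U = conv T (conv S U)"
proof
  fix a
  have "conv (conv T S) U a =
      sweedler (\<lambda>x z. sweedler (\<lambda>u v. mu (mu (T u) (S v)) (U z)) x) a"
    \<comment> \<open>The outer convolution is expanded first, since its equation mentions the inner
      one in unexpanded form.\<close>
    unfolding conv_eq_sweedler[OF linear_conv[OF T S] U] unfolding conv_eq_sweedler[OF T S]
    by (simp add: linear_sweedler_commute[OF mu_linear_left])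
  also have "\<dots> = sweedler (\<lambda>x y. sweedler (\<lambda>u v. mu (mu (T x) (S u)) (U v)) y) a"
    by (rule sweedler_coassoc)
      (intro linear_mu_left_comp linear_mu_right_comp T S U)+
  also have "\<dots> = conv T (conv S U) a"
    unfolding conv_eq_sweedler[OF T linear_conv[OF S U]] unfolding conv_eq_sweedler[OF S U]
    by (simp add: linear_sweedler_commute[OF mu_linear_right] mu_assoc)
  finally show "conv (conv T S) U a = conv T (conv S U) a" .
qed

text \<open>In Sweedler notation, \<open>id * T\<close> is applied to u S(v), where u and v are the
  legs of \<open>a\<close>. Splitting the coproduct of this product gives one term in the legs of
  S(v), which is \<open>id\<close> convolved with \<open>conv id T \<circ> S\<close>, and one in the
  legs of u.\<close>

lemma rota_baxter_conv_id_left: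
  assumes T: "Vector_Spaces.linear scale scale T"
    and S: "Vector_Spaces.linear scale scale S"
  shows "conv id T \<circ> conv id S = conv id ((conv id T \<circ> S) + (T \<circ> conv id S))"
proof
  fix a
  note lin = linear_mu_left_comp linear_mu_right_comp linear_ident T S
    Vector_Spaces.linear_compose[OF _ T, unfolded comp_def]
  have LT: "Vector_Spaces.linear scale scale (conv id T)" and
    LS: "Vector_Spaces.linear scale scale (conv id S)"
    using linear_conv T S linear_id by blast+
  have sum: "Vector_Spaces.linear scale scale ((conv id T \<circ> S) + (T \<circ> conv id S))"
    unfolding plus_fun_def
    by (intro endo.linear_compose_add Vector_Spaces.linear_compose[OF S LT]
        Vector_Spaces.linear_compose[OF LS T])
  have "(conv id T \<circ> conv id S) a = sweedler (\<lambda>u v. conv id T (mu u (S v))) a"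
    by (simp add: conv_id_left[OF S] linear_sweedler_commute[OF LT])
  also have "\<dots> = sweedler (\<lambda>u v. sweedler (\<lambda>x y. mu u (mu x (T y))) (S v)) a
      + sweedler (\<lambda>u v. sweedler (\<lambda>x y. mu x (T (mu y (S v)))) u) a"
    unfolding conv_id_left[OF T]
    by (subst sweedler_mu) (auto intro!: lin simp: mu_assoc sweedler_add)
  \<comment> \<open>Coassociativity moves the second splitting from the left leg to the right one,
    where it forms \<open>T \<circ> conv id S\<close>.\<close>
  also have "sweedler (\<lambda>u v. sweedler (\<lambda>x y. mu x (T (mu y (S v)))) u) a
      = sweedler (\<lambda>u v. sweedler (\<lambda>x y. mu u (T (mu x (S y)))) v) a"
    by (rule sweedler_coassoc) (intro lin)+
  also have "sweedler (\<lambda>u v. sweedler (\<lambda>x y. mu u (mu x (T y))) (S v)) a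
      + sweedler (\<lambda>u v. sweedler (\<lambda>x y. mu u (T (mu x (S y)))) v) a
      = conv id ((conv id T \<circ> S) + (T \<circ> conv id S)) a"
    \<comment> \<open>The first pass splits the outer convolution over the sum; the second expands
      the inner convolutions.\<close>
    by (simp add: conv_id_left[OF sum] endo.linear_add[OF mu_linear_right] sweedler_add)
      (simp add: conv_id_left[OF T] conv_id_left[OF S] linear_sweedler_commute[OF T]
        linear_sweedler_commute[OF mu_linear_right])
  finally show "(conv id T \<circ> conv id S) a = conv id ((conv id T \<circ> S) + (T \<circ> conv id S)) a" .
qed

text \<open>The mirror image of the left case: now the term in the legs of \<open>v\<close> is the
  one that coassociativity moves, to the left leg.\<close>

lemma rota_baxter_conv_id_right:
  assumes T: "Vector_Spaces.linear scale scale T"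
    and S: "Vector_Spaces.linear scale scale S"
  shows "conv T id \<circ> conv S id = conv ((conv T id \<circ> S) + (T \<circ> conv S id)) id"
proof
  fix a
  note lin = linear_mu_left_comp linear_mu_right_comp linear_ident T S
    Vector_Spaces.linear_compose[OF _ T, unfolded comp_def]
  have RT: "Vector_Spaces.linear scale scale (conv T id)" and
    RS: "Vector_Spaces.linear scale scale (conv S id)"
    using linear_conv T S linear_id by blast+
  have sum: "Vector_Spaces.linear scale scale ((conv T id \<circ> S) + (T \<circ> conv S id))"
    unfolding plus_fun_def
    by (intro endo.linear_compose_add Vector_Spaces.linear_compose[OF S RT]
        Vector_Spaces.linear_compose[OF RS T])
  have "(conv T id \<circ> conv S id) a = sweedler (\<lambda>u v. conv T id (mu (S u) v)) a"
    by (simp add: conv_id_right[OF S] linear_sweedler_commute[OF RT])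
  also have "\<dots> = sweedler (\<lambda>u v. sweedler (\<lambda>x y. mu (T (mu (S u) x)) y) v) a
      + sweedler (\<lambda>u v. sweedler (\<lambda>x y. mu (mu (T x) y) v) (S u)) a"
    unfolding conv_id_right[OF T]
    by (subst sweedler_mu) (auto intro!: lin simp: mu_assoc sweedler_add)
  also have "sweedler (\<lambda>u v. sweedler (\<lambda>x y. mu (T (mu (S u) x)) y) v) a
      = sweedler (\<lambda>u v. sweedler (\<lambda>x y. mu (T (mu (S x) y)) v) u) a"
    by (rule sweedler_coassoc[symmetric]) (intro lin)+
  also have "sweedler (\<lambda>u v. sweedler (\<lambda>x y. mu (T (mu (S x) y)) v) u) a
      + sweedler (\<lambda>u v. sweedler (\<lambda>x y. mu (mu (T x) y) v) (S u)) a
      = conv ((conv T id \<circ> S) + (T \<circ> conv S id)) id a"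
    by (simp add: conv_id_right[OF sum] endo.linear_add[OF mu_linear_left] sweedler_add)
      (simp add: conv_id_right[OF T] conv_id_right[OF S] linear_sweedler_commute[OF T]
        linear_sweedler_commute[OF mu_linear_left])
  finally show "(conv T id \<circ> conv S id) a = conv ((conv T id \<circ> S) + (T \<circ> conv S id)) id a" .
qed

section \<open>The commuting pair on the linear endomorphisms\<close>

lemma conv_id_add_scale:
  assumes T: "Vector_Spaces.linear scale scale T"
    and S: "Vector_Spaces.linear scale scale S"
  shows "conv id (T + S) = conv id T + conv id S"
    and "conv (T + S) id = conv T id + conv S id"
    and "conv id (\<lambda>x. scale c (T x)) = (\<lambda>x. scale c (conv id T x))"
    and "conv (\<lambda>x. scale c (T x)) id = (\<lambda>x. scale c (conv T id x))"
proof -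
  have add: "Vector_Spaces.linear scale scale (T + S)"
    unfolding plus_fun_def by (intro endo.linear_compose_add T S)
  have sc: "Vector_Spaces.linear scale scale (\<lambda>x. scale c (T x))"
    by (intro endo.linear_compose_scale_right T)
  show "conv id (T + S) = conv id T + conv id S"
    by (rule ext) (simp add: conv_id_left T S add endo.linear_add[OF mu_linear_right] sweedler_add)
  show "conv (T + S) id = conv T id + conv S id"
    by (rule ext) (simp add: conv_id_right T S add endo.linear_add[OF mu_linear_left] sweedler_add)
  show "conv id (\<lambda>x. scale c (T x)) = (\<lambda>x. scale c (conv id T x))"
    by (rule ext) (simp add: conv_id_left T sc endo.linear_scale[OF mu_linear_right]
        linear_sweedler_commute[OF linear_scale_self])
  show "conv (\<lambda>x. scale c (T x)) id = (\<lambda>x. scale c (conv T id x))"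
    by (rule ext) (simp add: conv_id_right T sc endo.linear_scale[OF mu_linear_left]
        linear_sweedler_commute[OF linear_scale_self])
qed

lemma commuting_rota_baxter_conv_id:
  "commuting_rota_baxter (\<lambda>c T x. scale c (T x)) {T. Vector_Spaces.linear scale scale T}
    (\<circ>) (conv id) (\<lambda>T. conv T id)"
proof -
  interpret E: vector_space "\<lambda>c (T :: 'a \<Rightarrow> 'a) x. scale c (T x)"
    by unfold_locales (auto simp: scale_right_distrib scale_left_distrib)
  have add: "Vector_Spaces.linear scale scale (T + S)"
    if "Vector_Spaces.linear scale scale T" "Vector_Spaces.linear scale scale S" for T S
    unfolding plus_fun_def by (intro endo.linear_compose_add that)
  show ?thesis
  proof (unfold_locales, goal_cases)
    case 1
    show ?case
      by (auto simp: E.subspace_def zero_fun_def endo.linear_zero add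
          endo.linear_compose_scale_right)
  next
    case 2
    show ?case
      by (auto simp: bilinear_on_def Vector_Spaces.linear_compose endo.linear_add
          endo.linear_scale fun_eq_iff)
  \<comment> \<open>Commutation of the two operators is \<open>conv_assoc\<close> with
    \<open>id\<close> in both outer places.\<close>
  qed (simp_all add: linear_conv linear_id conv_assoc conv_id_add_scale o_assoc
      rota_baxter_conv_id_left rota_baxter_conv_id_right)
qed

end

theorem corollary3p3:
  fixes scale :: "'k::field \<Rightarrow> 'a::ab_group_add \<Rightarrow> 'a"
    and mu :: "'a \<Rightarrow> 'a \<Rightarrow> 'a"
    and Delta :: "'a \<Rightarrow> (('a \<times> 'a) \<Rightarrow>\<^sub>0 'k) set"
  assumes "infinitesimal_bialgebra scale mu Delta"
  shows "let conv = convolution scale mu Delta;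
             se = (\<lambda>T S. conv (conv id T) id \<circ> S);
             ne = (\<lambda>T S. conv id T \<circ> conv S id);
             nw = (\<lambda>T S. T \<circ> conv (conv id S) id);
             sw = (\<lambda>T S. conv T id \<circ> conv id S)
         in quadri_algebra (\<lambda>c T x. scale c (T x)) {T. Vector_Spaces.linear scale scale T}
              se ne nw sw"
proof -
  interpret infinitesimal_bialgebra scale mu Delta by fact
  interpret E: commuting_rota_baxter "\<lambda>c T x. scale c (T x)"
    "{T. Vector_Spaces.linear scale scale T}" "(\<circ>)" "conv id" "\<lambda>T. conv T id"
    by (rule commuting_rota_baxter_conv_id)
  \<comment> \<open>For this pair \<open>R (L T)\<close> is \<open>conv (conv id T) id\<close>, so
    the operations of the abstract quadri-algebra are literally the four stated ones.\<close>
  show ?thesis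
    unfolding Let_def by (rule E.quadri_algebra_axioms)
qed

end
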